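(* Let $K_1,\dots,K_r\subset\mathbb{R}^n$ be closed convex sets and $K:=\bigcap_{l=1}^r K_l$. Suppose the SHQP algorithm (described in the context) with parameter $\bar p$ produces a sequence $\{x_i\}$ that converges to a point $\bar x\in K$, and that the convergence is not finite. Suppose that if $\sum_{l=1}^r v_l=0$ for some $v_l\in N_{K_l}(\bar x)$, then $v_l=0$ for all $l=1,\dots,r$. This condition implies that $\{K_l\}_{l=1}^r$ satisfies the local metric inequality at $\bar x$ with some constant $\bar\kappa$. Let $\bar\alpha$ be such that $$\bar\alpha<\sin^{-1}(1/\bar\kappa),$$ and suppose that the parameter $\bar p$ is sufficiently large so that for any $\bar p$ unit vectors in $\mathbb{R}^n$, there are two vectors such that the angle between them is at most $\bar\alpha$. Suppose also that $S_i=\{\max(0,i-\bar p),\dots,i\}\times\{1,\dots,r\}$ for all $i$. Then $\{x_i\}$ converges $\bar p$-term superlinearly to $\bar x$, i.e., $$\lim_{i\to\infty}\frac{\|x_{i+\bar p}-\bar x\|}{\|x_i-\bar x\|}=0.$$ If in addition the sets $K_l$ have the SOSH property at $\bar x$ for all $l\in\{1,\dots,r\}$, then $\{x_i\}$ converges $\bar p$-term quadratically to $\bar x$, i.e., $$\limsup_{i\to\infty}\frac{\|x_{i+\bar p}-\bar x\|}{\|x_i-\bar x\|^2}<\infty.$$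
   Context: Notation: $P_C$ is the Euclidean projection onto a closed convex set $C$; $N_C(x)=\{v\mid\langle v,y-x\rangle\le 0\ \forall y\in C\}$ is the normal cone at $x\in C$; $\mathbb{B}_\delta(x)$ is the closed ball of radius $\delta$ about $x$; $\mathrm{conv}$ is the convex hull; $\mathrm{pos}(S)=\{ts\mid t\ge 0,\ s\in S\}$; $d(x,S)$ is the distance from $x$ to $S$. SHQP algorithm for finding a point in $K=\bigcap_{l=1}^r K_l$. Given a starting point $x_0\in\mathbb{R}^n$ and a positive integer $\bar p$, for $i=0,1,2,\dots$: Step 1. For $l\in\{1,\dots,r\}$ set $x_i^{(l)}=P_{K_l}(x_i)$, $a_i^{(l)}=x_i-x_i^{(l)}$, $b_i^{(l)}=\langle a_i^{(l)},x_i^{(l)}\rangle$. Step 2. Choose $S_i\subset\{\max(i-\bar p,0),\dots,i\}\times\{1,\dots,r\}$ and define $\tilde F_i=\bigcap_{(j,l)\in S_i}H^{\le}_{(j,l)}$, where $H^{\le}_{(j,l)}=\{x:\langle a_j^{(l)},x\rangle\le b_j^{(l)}\}$. Choose $x_{i+1}$ such that (1) $x_{i+1}\in\tilde F_i$; (2) $\|x_{i+1}-c\|\le\|x_i-c\|$ for all $c\in K$; (3) $x_i-x_{i+1}\in\mathrm{pos}\big(\mathrm{conv}\{a_j^{(l)}:(j,l)\in S_i\}\big)$. "The convergence is not finite" means that $x_i\ne\bar x$ for all $i$. Local metric inequality: a collection of closed sets $K_l$, $l=1,\dots,r$, satisfies the local metric inequality at $\bar x$ with constant $\bar\kappa>0$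 if there is $\delta>0$ such that $d(x,\bigcap_{l=1}^rK_l)\le\bar\kappa\max_{1\le l\le r}d(x,K_l)$ for all $x\in\mathbb{B}_\delta(\bar x)$. SOSH: a closed convex set $C\subset\mathbb{R}^n$ has the second order supporting hyperplane (SOSH) property at $\bar x\in C$ if there are $\delta>0$ and $M>0$ such that for any $x\in[\mathbb{B}_\delta(\bar x)\cap C]\setminus\{\bar x\}$ and any $v\in N_C(x)$ with $\|v\|=1$, we have $0\le-\langle v,\bar x-x\rangle\le M\|\bar x-x\|^2$. *)

theory Defs
  imports "HOL-Analysis.Analysis"
begin

definition normal_cone :: "'a::real_inner set \<Rightarrow> 'a \<Rightarrow> 'a set" where
  "normal_cone C x = {v. \<forall>y\<in>C. v \<bullet> (y - x) \<le> 0}"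

definition pos :: "'a::real_vector set \<Rightarrow> 'a set" where
  "pos S = {t *\<^sub>R s | t s. 0 \<le> t \<and> s \<in> S}"

definition angle :: "'a::real_inner \<Rightarrow> 'a \<Rightarrow> real" where
  "angle u v = arccos ((u \<bullet> v) / (norm u * norm v))"

definition local_metric_inequality ::
    "nat \<Rightarrow> (nat \<Rightarrow> 'a::metric_space set) \<Rightarrow> 'a \<Rightarrow> real \<Rightarrow> bool" where
  "local_metric_inequality r K xbar \<kappa> \<longleftrightarrow>
     (\<exists>\<delta>>0. \<forall>x\<in>cball xbar \<delta>.
        infdist x (\<Inter>l\<in>{1..r}. K l) \<le> \<kappa> * Max ((\<lambda>l. infdist x (K l)) ` {1..r}))"

definition SOSH :: "'a::real_inner set \<Rightarrow> 'a \<Rightarrow> bool" where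
  "SOSH C xbar \<longleftrightarrow>
     (\<exists>\<delta>>0. \<exists>M>0. \<forall>x\<in>(cball xbar \<delta> \<inter> C) - {xbar}. \<forall>v\<in>normal_cone C x.
        norm v = 1 \<longrightarrow>
          0 \<le> - (v \<bullet> (xbar - x)) \<and> - (v \<bullet> (xbar - x)) \<le> M * (norm (xbar - x))\<^sup>2)"

text \<open>
  For an iterate \<open>x\<close> and a set \<open>C\<close>, the following are the vector \<open>a\<close> and the halfspace
  generated by projecting \<open>x\<close> onto \<open>C\<close>; if \<open>x \<in> C\<close> then \<open>a = 0\<close> and the halfspace is the
  whole space.
\<close>

definition shqp_a :: "'a::euclidean_space set \<Rightarrow> 'a \<Rightarrow> 'a" where
  "shqp_a C x = x - closest_point C x"

definition shqp_b :: "'a::euclidean_space set \<Rightarrow> 'a \<Rightarrow> real" where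
  "shqp_b C x = shqp_a C x \<bullet> closest_point C x"

definition shqp_halfspace :: "'a::euclidean_space set \<Rightarrow> 'a \<Rightarrow> 'a set" where
  "shqp_halfspace C x = {y. shqp_a C x \<bullet> y \<le> shqp_b C x}"

text \<open>
  \<open>shqp r K p S x\<close>: the sequence \<open>x\<close> is a possible run of the algorithm for \<open>K 1, \<dots>, K r\<close> with
  memory parameter \<open>p\<close> and index sets \<open>S i\<close>. Neither \<open>S i\<close> nor \<open>x (Suc i)\<close> is determined by the
  previous iterates, so a run is a relation. Subtraction on \<open>nat\<close> truncates, so \<open>i - p\<close> is
  \<open>max (i - p) 0\<close> of the integers.
\<close>

definition shqp ::
    "nat \<Rightarrow> (nat \<Rightarrow> 'a::euclidean_space set) \<Rightarrow> nat \<Rightarrow> (nat \<Rightarrow> (nat \<times> nat) set) \<Rightarrow> (nat \<Rightarrow> 'a) \<Rightarrow> bool"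
  where
  "shqp r K p S x \<longleftrightarrow> 0 < p \<and>
     (\<forall>i. S i \<subseteq> {i - p..i} \<times> {1..r} \<and>
          x (Suc i) \<in> (\<Inter>(j, l)\<in>S i. shqp_halfspace (K l) (x j)) \<and>
          (\<forall>c\<in>(\<Inter>l\<in>{1..r}. K l). norm (x (Suc i) - c) \<le> norm (x i - c)) \<and>
          x i - x (Suc i) \<in> pos (convex hull ((\<lambda>(j, l). shqp_a (K l) (x j)) ` S i)))"

end

theory Submission
  imports Defs
begin

text \<open>
  The metric inequality is proved by penalisation. For \<open>x\<close> near the limit, a minimiser \<open>z\<close> of
  \<open>\<parallel>z - x\<parallel>\<^sup>2 + \<rho> (\<Sum>l. d(z, K l)\<^sup>2)\<close> writes \<open>x - z\<close> as a sum of normals to the individual sets at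
  nearby points. The qualification, made uniform near the limit by compactness
  (\<open>normals_do_not_cancel_nearby\<close>), bounds the total length of these normals by a multiple of
  \<open>\<parallel>x - z\<parallel>\<close>, and this bounds \<open>\<parallel>x - z\<parallel>\<close> by a multiple of \<open>Max d(x, K l)\<close>. The bound is independent of
  \<open>\<rho>\<close>, so it survives \<open>\<rho> \<rightarrow> \<infinity>\<close>, when \<open>z\<close> approaches the intersection.

  The rates rest on two facts. First, the iterates are Fejer monotone with respect to the
  intersection \<open>D\<close>, and a Fejer monotone sequence can approach its limit only along normals to \<open>D\<close>
  (\<open>fejer_direction_nearly_normal\<close>). Hence the distance of an iterate to \<open>D\<close> is asymptotically its
  distance to the limit, and by the metric inequality some \<open>K l\<close> is at least about \<open>1 / \<kappa>\<close> times
  that far away. Second, the boundary of the halfspace generated by projecting an iterate \<open>x j\<close>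
  passes very close to the limit: within \<open>o(\<parallel>x j - xbar\<parallel>)\<close> in general
  (\<open>supporting_hyperplane_near\<close>), within \<open>O(\<parallel>x j - xbar\<parallel>\<^sup>2)\<close> under the second order condition.

  All halfspaces of a window are remembered. An iterate \<open>x k\<close> later in the window than \<open>x j\<close> thus
  satisfies a linear inequality whose normal makes an angle of at most about \<open>arccos (1 / \<kappa>)\<close> with
  \<open>x j - xbar\<close>. If \<open>x k\<close> is far from the limit compared with the offset of that halfspace, then
  \<open>x k - xbar\<close> is nearly at a right angle or more to the normal, so the two directions differ by
  nearly \<open>arcsin (1 / \<kappa>)\<close> or more. The hypothesis on \<open>p\<close> excludes this for
  some pair \<open>j < k\<close> of every window, and for that pair \<open>\<parallel>x k - xbar\<parallel>\<close> is of the order of the offset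
  (\<open>shqp_window_estimate\<close>). Monotonicity of the distance to the limit carries the estimate to the
  ends of the window.
\<close>

section \<open>Normal cones near a point\<close>

lemma normal_coneD: "v \<in> normal_cone C x \<Longrightarrow> y \<in> C \<Longrightarrow> v \<bullet> (y - x) \<le> 0"
  by (simp add: normal_cone_def)

lemma normal_cone_scaleR:
  assumes "0 \<le> c" "v \<in> normal_cone C x"
  shows "c *\<^sub>R v \<in> normal_cone C x"
  using assms by (simp add: normal_cone_def mult_nonneg_nonpos)

lemma normal_cone_closed_graph:
  assumes y: "y \<longlonglongrightarrow> b" and v: "v \<longlonglongrightarrow> w"
    and n: "\<And>n. v n \<in> normal_cone C (y n)"
  shows "w \<in> normal_cone C b"
proof -
  have "w \<bullet> (c - b) \<le> 0" if "c \<in> C" for c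
  proof (rule LIMSEQ_le_const2)
    show "(\<lambda>n. v n \<bullet> (c - y n)) \<longlonglongrightarrow> w \<bullet> (c - b)"
      by (intro tendsto_intros v y)
    show "\<exists>N. \<forall>n\<ge>N. v n \<bullet> (c - y n) \<le> 0"
      using n that normal_coneD by blast
  qed
  then show ?thesis by (simp add: normal_cone_def)
qed

text \<open>
  Compactness turns knowledge of limits into knowledge of tails: what is known of every subsequential limit holds
  approximately, and uniformly, on a tail of the sequence itself.
\<close>

lemma eventually_near_cluster_set:
  fixes u :: "nat \<Rightarrow> 'a::heine_borel"
  assumes bdd: "bounded (range u)"
    and cl: "\<And>s w. strict_mono s \<Longrightarrow> (u \<circ> s) \<longlonglongrightarrow> w \<Longrightarrow> w \<in> N"
    and "0 < e"
  shows "\<forall>\<^sub>F n in sequentially. \<exists>w\<in>N. dist (u n) w < e"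
proof (rule ccontr)
  assume "\<not> ?thesis"
  then have "\<exists>\<^sub>F n in sequentially. \<forall>w\<in>N. e \<le> dist (u n) w"
    by (simp add: not_eventually not_less)
  then have inf: "infinite {n. \<forall>w\<in>N. e \<le> dist (u n) w}"
    by (simp add: frequently_cofinite flip: cofinite_eq_sequentially)
  define t where "t = enumerate {n. \<forall>w\<in>N. e \<le> dist (u n) w}"
  have t: "strict_mono t" "\<And>n w. w \<in> N \<Longrightarrow> e \<le> dist (u (t n)) w"
    using enumerate_in_set[OF inf] strict_mono_enumerate[OF inf] by (auto simp: t_def)
  have "bounded (range (u \<circ> t))"
    using bdd by (rule bounded_subset) auto
  from bounded_imp_convergent_subsequence[OF this] obtain w s
    where s: "strict_mono s" "((u \<circ> t) \<circ> s) \<longlonglongrightarrow> w" by blast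
  have "w \<in> N"
    using cl[OF strict_mono_o[OF t(1) s(1)]] s(2) by (simp add: o_assoc)
  moreover have "\<forall>\<^sub>F n in sequentially. dist (((u \<circ> t) \<circ> s) n) w < e"
    using s(2) \<open>0 < e\<close> by (rule tendstoD)
  then obtain n where "dist (u (t (s n))) w < e"
    by (auto simp: eventually_sequentially)
  ultimately show False using t(2) by (meson not_less)
qed

text \<open>
  A supporting hyperplane at a point \<open>y\<close> of \<open>C\<close> misses \<open>b\<close> by only \<open>o(\<parallel>y - b\<parallel>)\<close>: its normal is
  nearly a normal \<open>w\<close> at \<open>b\<close>, and \<open>w \<bullet> (y - b) \<le> 0\<close>.
\<close>

lemma supporting_hyperplane_near:
  fixes C :: "'a::euclidean_space set"
  assumes "0 < e"
  obtains d where "0 < d"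
    "\<And>y v. y \<in> C \<Longrightarrow> dist y b \<le> d \<Longrightarrow> v \<in> normal_cone C y \<Longrightarrow> norm v = 1
      \<Longrightarrow> v \<bullet> (y - b) \<le> e * norm (y - b)"
proof (rule ccontr)
  assume "\<not> thesis"
  with that have "\<forall>d>0. \<exists>y v. y \<in> C \<and> dist y b \<le> d \<and> v \<in> normal_cone C y \<and> norm v = 1
      \<and> e * norm (y - b) < v \<bullet> (y - b)"
    by (metis not_less)
  then have "\<forall>n. \<exists>y v. y \<in> C \<and> dist y b \<le> inverse (Suc n) \<and> v \<in> normal_cone C y \<and> norm v = 1
      \<and> e * norm (y - b) < v \<bullet> (y - b)"
    by simp
  then obtain y v where yv: "\<And>n. y n \<in> C" "\<And>n. dist (y n) b \<le> inverse (Suc n)"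
    "\<And>n. v n \<in> normal_cone C (y n)" "\<And>n. norm (v n) = 1"
    "\<And>n. e * norm (y n - b) < v n \<bullet> (y n - b)"
    by metis
  have "(\<lambda>n. dist (y n) b) \<longlonglongrightarrow> 0"
    by (rule real_tendsto_sandwich[OF _ _ tendsto_const LIMSEQ_inverse_real_of_nat])
      (use yv(2) in auto)
  then have y: "y \<longlonglongrightarrow> b" by (rule tendsto_dist_iff[THEN iffD2])
  have "\<forall>\<^sub>F n in sequentially. \<exists>w\<in>normal_cone C b. dist (v n) w < e"
  proof (rule eventually_near_cluster_set[OF _ _ assms])
    show "bounded (range v)"
      using yv(4) by (auto simp: bounded_iff)
    fix s w assume s: "strict_mono s" "(v \<circ> s) \<longlonglongrightarrow> w"
    show "w \<in> normal_cone C b"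
      by (rule normal_cone_closed_graph[OF LIMSEQ_subseq_LIMSEQ[OF y s(1)] s(2)]) (simp add: yv)
  qed
  then obtain n w where w: "w \<in> normal_cone C b" "dist (v n) w < e"
    by (auto simp: eventually_sequentially)
  have "v n \<bullet> (y n - b) = w \<bullet> (y n - b) + (v n - w) \<bullet> (y n - b)"
    by (simp add: inner_diff_left)
  also have "\<dots> \<le> 0 + norm (v n - w) * norm (y n - b)"
    by (intro add_mono normal_coneD[OF w(1)] yv norm_cauchy_schwarz)
  also have "\<dots> \<le> e * norm (y n - b)"
    using w(2) by (simp add: dist_norm mult_right_mono)
  finally show False using yv(5)[of n] by simp
qed

section \<open>Existence of a local metric inequality\<close>

lemma simultaneous_convergent_subsequence:
  fixes f :: "nat \<Rightarrow> 'i \<Rightarrow> 'a::heine_borel"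
  assumes "finite I" "\<And>l. l \<in> I \<Longrightarrow> bounded (range (\<lambda>n. f n l))"
  shows "\<exists>s w. strict_mono s \<and> (\<forall>l\<in>I. (\<lambda>n. f (s n) l) \<longlonglongrightarrow> w l)"
  using assms
proof (induction I)
  case empty
  show ?case by (rule exI[of _ id]) (auto simp: strict_mono_def)
next
  case (insert k I)
  then obtain s w where s: "strict_mono s" "\<And>l. l \<in> I \<Longrightarrow> (\<lambda>n. f (s n) l) \<longlonglongrightarrow> w l"
    by auto
  have "bounded (range (\<lambda>n. f (s n) k))"
    by (rule bounded_subset[OF insert.prems[of k]]) auto
  from bounded_imp_convergent_subsequence[OF this] obtain z t
    where t: "strict_mono t" "(\<lambda>n. f (s (t n)) k) \<longlonglongrightarrow> z" by (auto simp: o_def)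
  have "\<forall>l\<in>insert k I. (\<lambda>n. f ((s \<circ> t) n) l) \<longlonglongrightarrow> (w(k := z)) l"
    using t LIMSEQ_subseq_LIMSEQ[OF s(2) t(1)] by (auto simp: o_def)
  then show ?case
    using strict_mono_o[OF s(1) t(1)] by blast
qed

text \<open>
  The qualification at \<open>b\<close> says that no nontrivial choice of normals at \<open>b\<close> cancels. By compactness
  it persists, in a quantitative form, for normals at nearby points, and the base points may
  differ from set to set.
\<close>

lemma normals_do_not_cancel_nearby:
  fixes K :: "'i \<Rightarrow> 'a::euclidean_space set"
  assumes fin: "finite I"
    and reg: "\<And>v. (\<forall>l\<in>I. v l \<in> normal_cone (K l) b) \<Longrightarrow> (\<Sum>l\<in>I. v l) = 0 \<Longrightarrow> \<forall>l\<in>I. v l = 0"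
  obtains d B where "0 < d" "0 < B"
    "\<And>y v. (\<And>l. l \<in> I \<Longrightarrow> dist (y l) b \<le> d) \<Longrightarrow> (\<And>l. l \<in> I \<Longrightarrow> v l \<in> normal_cone (K l) (y l))
      \<Longrightarrow> (\<Sum>l\<in>I. norm (v l)) \<le> B * norm (\<Sum>l\<in>I. v l)"
proof (rule ccontr)
  assume "\<not> thesis"
  with that have neg: "\<forall>d>0. \<forall>B>0. \<exists>y v. (\<forall>l\<in>I. dist (y l) b \<le> d \<and> v l \<in> normal_cone (K l) (y l))
      \<and> B * norm (\<Sum>l\<in>I. v l) < (\<Sum>l\<in>I. norm (v l))"
    by (metis not_less)
  have "\<exists>y v. (\<forall>l\<in>I. dist (y l) b \<le> inverse (Suc n) \<and> v l \<in> normal_cone (K l) (y l))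
      \<and> Suc n * norm (\<Sum>l\<in>I. v l) < (\<Sum>l\<in>I. norm (v l))" for n
    using neg[rule_format, of "inverse (Suc n)" "Suc n"] by simp
  then obtain y v where
    yv: "\<And>n l. l \<in> I \<Longrightarrow> dist (y n l) b \<le> inverse (Suc n)"
      "\<And>n l. l \<in> I \<Longrightarrow> v n l \<in> normal_cone (K l) (y n l)"
      "\<And>n. Suc n * norm (\<Sum>l\<in>I. v n l) < (\<Sum>l\<in>I. norm (v n l))"
    by metis
  define T where "T n = (\<Sum>l\<in>I. norm (v n l))" for n
  define u where "u n l = (1 / T n) *\<^sub>R v n l" for n l
  have T: "T n > 0" for n
    unfolding T_def by (rule le_less_trans[OF _ yv(3)[of n]]) simp
  have sum1: "(\<Sum>l\<in>I. norm (u n l)) = 1" for n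
    using T[of n] by (simp add: u_def flip: sum_divide_distrib T_def)
  have small: "norm (\<Sum>l\<in>I. u n l) \<le> inverse (Suc n)" for n
  proof -
    have "(\<Sum>l\<in>I. u n l) = (1 / T n) *\<^sub>R (\<Sum>l\<in>I. v n l)"
      by (simp add: u_def scaleR_sum_right)
    then have "norm (\<Sum>l\<in>I. u n l) = norm (\<Sum>l\<in>I. v n l) / T n"
      using T[of n] by simp
    also have "\<dots> \<le> inverse (Suc n)"
      using T[of n] yv(3)[of n] by (simp add: field_simps flip: T_def)
    finally show ?thesis .
  qed
  have bdd: "bounded (range (\<lambda>n. u n l))" if "l \<in> I" for l
  proof -
    have "norm (u n l) \<le> 1" for n
      using member_le_sum[OF that, of "\<lambda>l. norm (u n l)"] fin sum1[of n] by simp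
    then show ?thesis by (auto simp: bounded_iff)
  qed
  obtain s w where s: "strict_mono s" "\<And>l. l \<in> I \<Longrightarrow> (\<lambda>n. u (s n) l) \<longlonglongrightarrow> w l"
    using simultaneous_convergent_subsequence[where f = u, OF fin bdd] by blast
  have inv: "(\<lambda>n. inverse (real (Suc (s n)))) \<longlonglongrightarrow> 0"
    using LIMSEQ_subseq_LIMSEQ[OF LIMSEQ_inverse_real_of_nat s(1)] by (simp add: o_def)
  have "w l \<in> normal_cone (K l) b" if "l \<in> I" for l
  proof (rule normal_cone_closed_graph[OF _ s(2)[OF that]])
    have "(\<lambda>n. dist (y (s n) l) b) \<longlonglongrightarrow> 0"
      by (rule real_tendsto_sandwich[OF _ _ tendsto_const inv]) (use yv(1)[OF that] in auto)
    then show "(\<lambda>n. y (s n) l) \<longlonglongrightarrow> b" by (rule tendsto_dist_iff[THEN iffD2])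
    show "u (s n) l \<in> normal_cone (K l) (y (s n) l)" for n
      unfolding u_def by (rule normal_cone_scaleR) (use T[of "s n"] yv(2)[OF that] in auto)
  qed
  moreover have "(\<Sum>l\<in>I. w l) = 0"
  proof -
    have "(\<lambda>n. \<Sum>l\<in>I. u (s n) l) \<longlonglongrightarrow> (\<Sum>l\<in>I. w l)"
      by (intro tendsto_sum s(2))
    moreover have "(\<lambda>n. \<Sum>l\<in>I. u (s n) l) \<longlonglongrightarrow> 0"
      by (rule Lim_null_comparison[OF _ inv]) (use small in auto)
    ultimately show ?thesis by (rule LIMSEQ_unique)
  qed
  ultimately have "\<forall>l\<in>I. w l = 0" using reg by blast
  moreover have "(\<lambda>n. \<Sum>l\<in>I. norm (u (s n) l)) \<longlonglongrightarrow> (\<Sum>l\<in>I. norm (w l))"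
    by (intro tendsto_sum tendsto_norm s(2))
  then have "(\<Sum>l\<in>I. norm (w l)) = 1"
    by (simp add: sum1 LIMSEQ_const_iff)
  ultimately show False by simp
qed

lemma shqp_a_normal:
  assumes "closed C" "convex C"
  shows "shqp_a C x \<in> normal_cone C (closest_point C x)"
  using assms by (auto simp: normal_cone_def shqp_a_def closest_point_dot)

lemma infdist_eq_norm_shqp_a:
  assumes "closed C" "C \<noteq> {}"
  shows "infdist x C = norm (shqp_a C x)"
  using setdist_closest_point[OF assms] by (simp add: infdist_eq_setdist shqp_a_def dist_norm)

lemma dist_closest_point_le:
  assumes "closed C" "convex C" "b \<in> C"
  shows "dist (closest_point C x) b \<le> dist x b"
  using closest_point_lipschitz[of C x b] assms closest_point_self[of b C] by auto

text \<open>
  The penalised problem of minimising \<open>\<parallel>z - x\<parallel>\<^sup>2 + \<rho> (\<Sum>l\<in>I. d(z, K l)\<^sup>2)\<close> replaces the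
  projection of \<open>x\<close> onto the intersection. Its stationarity condition expresses \<open>x - z\<close> as a sum of
  normals to the individual sets, without any sum rule for normal cones of intersections.
\<close>

lemma penalised_projection:
  fixes K :: "'i \<Rightarrow> 'a::euclidean_space set"
  assumes fin: "finite I" and K: "\<And>l. l \<in> I \<Longrightarrow> closed (K l) \<and> b \<in> K l"
    and rho: "0 < \<rho>"
  obtains z where "dist z x \<le> dist x b" "x - z = (\<Sum>l\<in>I. \<rho> *\<^sub>R shqp_a (K l) z)"
    "\<And>l. l \<in> I \<Longrightarrow> \<rho> * (infdist z (K l))\<^sup>2 \<le> (dist x b)\<^sup>2"
proof -
  define f where "f z = (norm (z - x))\<^sup>2 + \<rho> * (\<Sum>l\<in>I. (infdist z (K l))\<^sup>2)" for z
  have fb: "f b = (dist x b)\<^sup>2"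
    using K by (simp add: f_def dist_norm norm_minus_commute)
  have f_ge: "(norm (z - x))\<^sup>2 \<le> f z" for z
    using rho by (simp add: f_def sum_nonneg)
  have "continuous_on (cball x (dist x b)) f"
    unfolding f_def by (intro continuous_intros)
  moreover have "b \<in> cball x (dist x b)" by simp
  ultimately obtain z where z: "z \<in> cball x (dist x b)" "\<forall>y\<in>cball x (dist x b). f z \<le> f y"
    using continuous_attains_inf[OF compact_cball] by (metis empty_iff)
  have min: "f z \<le> f y" for y
  proof (cases "y \<in> cball x (dist x b)")
    case False
    then have "dist x b \<le> norm (y - x)" by (simp add: dist_norm norm_minus_commute)
    then have "f b \<le> (norm (y - x))\<^sup>2" unfolding fb by (intro power_mono) auto
    then show ?thesis using f_ge[of y] z(2) \<open>b \<in> cball x (dist x b)\<close> by (meson order_trans)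
  qed (use z in auto)
  define g where "g = (z - x) + (\<Sum>l\<in>I. \<rho> *\<^sub>R shqp_a (K l) z)"
  have g0: "g = 0"
  proof -
    \<comment> \<open>Freezing the projections bounds \<open>f (z - t *\<^sub>R g)\<close> by a quadratic in \<open>t\<close>; this \<open>t\<close> minimises it.\<close>
    define t where "t = 1 / (1 + \<rho> * card I)"
    have pos: "0 < 1 + \<rho> * card I" using rho by (simp add: add_pos_nonneg)
    have t: "0 < t" using pos by (simp add: t_def)
    have sq: "(norm (a - t *\<^sub>R g))\<^sup>2 = (norm a)\<^sup>2 - 2 * t * (a \<bullet> g) + t\<^sup>2 * (norm g)\<^sup>2" for a
      unfolding power2_norm_eq_inner
      by (simp add: inner_diff_left inner_diff_right inner_commute[of g a]
          power2_eq_square algebra_simps)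
    have inf: "(infdist (z - t *\<^sub>R g) (K l))\<^sup>2 \<le> (infdist z (K l))\<^sup>2
        - 2 * t * (shqp_a (K l) z \<bullet> g) + t\<^sup>2 * (norm g)\<^sup>2" if l: "l \<in> I" for l
    proof -
      have "closest_point (K l) z \<in> K l" using K[OF l] by (auto intro: closest_point_in_set)
      then have "infdist (z - t *\<^sub>R g) (K l) \<le> norm (shqp_a (K l) z - t *\<^sub>R g)"
        using infdist_le[of "closest_point (K l) z" "K l" "z - t *\<^sub>R g"]
        by (simp add: dist_norm shqp_a_def algebra_simps)
      then have "(infdist (z - t *\<^sub>R g) (K l))\<^sup>2 \<le> (norm (shqp_a (K l) z - t *\<^sub>R g))\<^sup>2"
        by (intro power_mono) (auto simp: infdist_nonneg)
      also have "\<dots> = (infdist z (K l))\<^sup>2 - 2 * t * (shqp_a (K l) z \<bullet> g) + t\<^sup>2 * (norm g)\<^sup>2"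
        using K[OF l] infdist_eq_norm_shqp_a[of "K l" z] by (metis sq empty_iff)
      finally show ?thesis .
    qed
    have "f z \<le> f (z - t *\<^sub>R g)" by (rule min)
    also have "\<dots> = (norm ((z - x) - t *\<^sub>R g))\<^sup>2
        + \<rho> * (\<Sum>l\<in>I. (infdist (z - t *\<^sub>R g) (K l))\<^sup>2)"
      by (simp add: f_def algebra_simps)
    also have "\<dots> \<le> ((norm (z - x))\<^sup>2 - 2 * t * ((z - x) \<bullet> g) + t\<^sup>2 * (norm g)\<^sup>2)
        + \<rho> * (\<Sum>l\<in>I. (infdist z (K l))\<^sup>2 - 2 * t * (shqp_a (K l) z \<bullet> g) + t\<^sup>2 * (norm g)\<^sup>2)"
      unfolding sq using rho by (intro add_mono order_refl mult_left_mono sum_mono inf) auto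
    also have "\<dots> = f z - 2 * t * (g \<bullet> g) + t\<^sup>2 * (norm g)\<^sup>2 * (1 + \<rho> * card I)"
    proof -
      have "g \<bullet> g = (z - x) \<bullet> g + \<rho> * (\<Sum>l\<in>I. shqp_a (K l) z \<bullet> g)"
        by (subst (1) g_def) (simp add: inner_add_left inner_sum_left sum_distrib_left)
      then show ?thesis
        unfolding f_def
        by (simp only:) (simp add: sum.distrib sum_subtractf algebra_simps flip: sum_distrib_left)
    qed
    also have "t\<^sup>2 * (norm g)\<^sup>2 * (1 + \<rho> * card I) = t * (g \<bullet> g)"
      unfolding power2_norm_eq_inner using pos by (simp add: t_def power2_eq_square)
    finally have "t * (g \<bullet> g) \<le> 0" by simp
    then show "g = 0" using t inner_ge_zero[of g] by (simp add: mult_le_0_iff)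
  qed
  show thesis
  proof
    show "dist z x \<le> dist x b" using z(1) by (simp add: dist_commute)
    show "x - z = (\<Sum>l\<in>I. \<rho> *\<^sub>R shqp_a (K l) z)" using g0 unfolding g_def by (simp add: algebra_simps)
    fix l assume l: "l \<in> I"
    have "(infdist z (K l))\<^sup>2 \<le> (\<Sum>l\<in>I. (infdist z (K l))\<^sup>2)"
      using member_le_sum[OF l, of "\<lambda>l. (infdist z (K l))\<^sup>2"] fin by simp
    then have "\<rho> * (infdist z (K l))\<^sup>2 \<le> \<rho> * (\<Sum>l\<in>I. (infdist z (K l))\<^sup>2)" using rho by simp
    also have "\<dots> \<le> f z" by (simp add: f_def)
    also have "\<dots> \<le> (dist x b)\<^sup>2" using min[of b] fb by simp
    finally show "\<rho> * (infdist z (K l))\<^sup>2 \<le> (dist x b)\<^sup>2" .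
  qed
qed

text \<open>
  For the penalised solution \<open>z\<close> the vectors \<open>v l = \<rho> *\<^sub>R (z - P z)\<close> are normals near \<open>b\<close> with sum
  \<open>x - z\<close>, so their total length is at most \<open>B * \<parallel>x - z\<parallel>\<close>. Pairing \<open>x - z\<close> with itself and moving
  both points to their projections gives \<open>\<parallel>x - z\<parallel>\<^sup>2 \<le> (\<Sum>l. \<parallel>v l\<parallel> * d(x, K l))\<close>. The resulting bound on
  \<open>\<parallel>x - z\<parallel>\<close> does not depend on \<open>\<rho>\<close>, and as \<open>\<rho>\<close> grows \<open>z\<close> accumulates at a point of the intersection.
\<close>

lemma local_metric_inequality_exists:
  fixes K :: "nat \<Rightarrow> 'a::euclidean_space set"
  assumes r: "1 \<le> r"
    and K: "\<And>l. l \<in> {1..r} \<Longrightarrow> closed (K l) \<and> convex (K l)"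
    and b: "b \<in> (\<Inter>l\<in>{1..r}. K l)"
    and reg: "\<And>v. (\<forall>l\<in>{1..r}. v l \<in> normal_cone (K l) b) \<Longrightarrow> (\<Sum>l=1..r. v l) = 0
      \<Longrightarrow> \<forall>l\<in>{1..r}. v l = 0"
  shows "\<exists>\<kappa>>0. local_metric_inequality r K b \<kappa>"
proof -
  obtain d B where d: "0 < d" and B: "0 < B"
    and dB: "\<And>y v. (\<And>l. l \<in> {1..r} \<Longrightarrow> dist (y l) b \<le> d)
        \<Longrightarrow> (\<And>l. l \<in> {1..r} \<Longrightarrow> v l \<in> normal_cone (K l) (y l))
        \<Longrightarrow> (\<Sum>l=1..r. norm (v l)) \<le> B * norm (\<Sum>l=1..r. v l)"
    using normals_do_not_cancel_nearby[where K = K and b = b, OF finite_atLeastAtMost reg] by blast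
  \<comment> \<open>The radius is halved because \<open>z\<close> may be twice as far from \<open>b\<close> as \<open>x\<close>.\<close>
  have "infdist x (\<Inter>l\<in>{1..r}. K l) \<le> B * Max ((\<lambda>l. infdist x (K l)) ` {1..r})"
    if x: "x \<in> cball b (d / 2)" for x
  proof -
    define D where "D = Max ((\<lambda>l. infdist x (K l)) ` {1..r})"
    have D: "infdist x (K l) \<le> D" if "l \<in> {1..r}" for l
      unfolding D_def by (rule Max_ge) (use that in auto)
    have xb: "dist x b \<le> d / 2" using x by (simp add: dist_commute)
    have Kb: "closed (K l) \<and> b \<in> K l" if "l \<in> {1..r}" for l using K b that by auto
    have "\<exists>z. dist z x \<le> dist x b \<and> x - z = (\<Sum>l=1..r. \<rho> *\<^sub>R shqp_a (K l) z) \<and>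
        (\<forall>l\<in>{1..r}. \<rho> * (infdist z (K l))\<^sup>2 \<le> (dist x b)\<^sup>2)" if "0 < \<rho>" for \<rho>
      by (rule penalised_projection[where x = x, OF finite_atLeastAtMost Kb that]) blast+
    then have "\<exists>z. dist z x \<le> dist x b \<and> x - z = (\<Sum>l=1..r. real (Suc n) *\<^sub>R shqp_a (K l) z) \<and>
        (\<forall>l\<in>{1..r}. real (Suc n) * (infdist z (K l))\<^sup>2 \<le> (dist x b)\<^sup>2)" for n
      by simp
    then obtain z where z: "\<And>n. dist (z n) x \<le> dist x b"
      "\<And>n. x - z n = (\<Sum>l=1..r. real (Suc n) *\<^sub>R shqp_a (K l) (z n))"
      "\<And>n l. l \<in> {1..r} \<Longrightarrow> real (Suc n) * (infdist (z n) (K l))\<^sup>2 \<le> (dist x b)\<^sup>2"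
      by metis
    have bound: "dist x (z n) \<le> B * D" for n
    proof -
      define v where "v l = real (Suc n) *\<^sub>R shqp_a (K l) (z n)" for l
      have v_sum: "x - z n = (\<Sum>l=1..r. v l)" using z(2)[of n] by (simp only: v_def)
      have "(\<Sum>l=1..r. norm (v l)) \<le> B * norm (\<Sum>l=1..r. v l)"
      proof (rule dB)
        fix l assume l: "l \<in> {1..r}"
        have "dist (z n) b \<le> d" using z(1)[of n] xb dist_triangle[of "z n" b x] by simp
        then show "dist (closest_point (K l) (z n)) b \<le> d"
          using dist_closest_point_le[of "K l" b "z n"] K[OF l] Kb[OF l] by auto
        show "v l \<in> normal_cone (K l) (closest_point (K l) (z n))"
          unfolding v_def using K[OF l] by (intro normal_cone_scaleR shqp_a_normal) auto
      qed
      then have vB: "(\<Sum>l=1..r. norm (v l)) \<le> B * norm (x - z n)" by (simp only: v_sum)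
      have pair: "v l \<bullet> (x - z n) \<le> norm (v l) * D" if l: "l \<in> {1..r}" for l
      proof -
        let ?a = "shqp_a (K l) (z n)" and ?P = "closest_point (K l)"
        have "?P x \<in> K l" using Kb[OF l] by (auto intro: closest_point_in_set)
        then have 1: "?a \<bullet> (?P x - ?P (z n)) \<le> 0"
          using K[OF l] shqp_a_normal normal_coneD by blast
        have 2: "?a \<bullet> (z n - ?P (z n)) \<ge> 0" by (simp add: shqp_a_def)
        have "norm (x - ?P x) = infdist x (K l)"
          using infdist_eq_norm_shqp_a[of "K l" x] Kb[OF l] by (metis empty_iff shqp_a_def)
        then have 3: "?a \<bullet> (x - ?P x) \<le> norm ?a * D"
          using D[OF l] norm_cauchy_schwarz[of ?a "x - ?P x"]
          by (metis mult_left_mono norm_ge_zero order_trans)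
        have "?a \<bullet> (x - z n) = ?a \<bullet> (x - ?P x) + ?a \<bullet> (?P x - ?P (z n)) - ?a \<bullet> (z n - ?P (z n))"
          by (simp add: inner_diff_right)
        then have "?a \<bullet> (x - z n) \<le> norm ?a * D" using 1 2 3 by linarith
        then have "real (Suc n) * (?a \<bullet> (x - z n)) \<le> real (Suc n) * (norm ?a * D)"
          by (rule mult_left_mono) simp
        then show ?thesis by (simp add: v_def)
      qed
      have "0 \<le> D" using D[of 1] r infdist_nonneg[of x "K 1"] by auto
      have "norm (x - z n) * norm (x - z n) = (x - z n) \<bullet> (x - z n)"
        by (simp add: power2_norm_eq_inner flip: power2_eq_square)
      also have "\<dots> = (\<Sum>l=1..r. v l \<bullet> (x - z n))"
        by (subst (1) v_sum) (simp add: inner_sum_left)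
      also have "\<dots> \<le> (\<Sum>l=1..r. norm (v l) * D)"
        by (intro sum_mono pair)
      also have "\<dots> \<le> B * norm (x - z n) * D"
        unfolding sum_distrib_right[symmetric] by (rule mult_right_mono[OF vB \<open>0 \<le> D\<close>])
      finally have "norm (x - z n) * norm (x - z n) \<le> norm (x - z n) * (B * D)"
        by (simp add: mult_ac)
      then show ?thesis
        using B \<open>0 \<le> D\<close> by (cases "x = z n") (simp_all add: dist_norm)
    qed
    have "bounded (range z)"
      using z(1) by (auto simp: bounded_def dist_commute)
    from bounded_imp_convergent_subsequence[OF this] obtain w s
      where s: "strict_mono s" "(\<lambda>n. z (s n)) \<longlonglongrightarrow> w" by (auto simp: o_def)
    have "w \<in> K l" if l: "l \<in> {1..r}" for l
    proof -
      have lim: "(\<lambda>n. (infdist (z (s n)) (K l))\<^sup>2) \<longlonglongrightarrow> (infdist w (K l))\<^sup>2"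
        by (intro tendsto_intros s(2))
      have "(\<lambda>n. (dist x b)\<^sup>2 * inverse (real (Suc n))) \<longlonglongrightarrow> (dist x b)\<^sup>2 * 0"
        by (intro tendsto_mult tendsto_const LIMSEQ_inverse_real_of_nat)
      from LIMSEQ_subseq_LIMSEQ[OF this s(1)]
      have "(\<lambda>n. (dist x b)\<^sup>2 * inverse (real (Suc (s n)))) \<longlonglongrightarrow> 0" by (simp add: o_def)
      moreover have "(infdist (z n) (K l))\<^sup>2 \<le> (dist x b)\<^sup>2 * inverse (real (Suc n))" for n
        using z(3)[OF l, of n] by (simp add: field_simps)
      ultimately have "(infdist w (K l))\<^sup>2 \<le> 0"
        using LIMSEQ_le[OF lim] by blast
      then have "infdist w (K l) = 0" by simp
      then show ?thesis using Kb[OF l] in_closed_iff_infdist_zero by blast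
    qed
    then have "infdist x (\<Inter>l\<in>{1..r}. K l) \<le> dist x w" by (intro infdist_le) auto
    also have "dist x w \<le> B * D"
      by (rule LIMSEQ_le_const2[OF tendsto_dist[OF tendsto_const s(2)]]) (use bound in auto)
    finally show ?thesis by (simp add: D_def)
  qed
  then show ?thesis
    unfolding local_metric_inequality_def using d B by (intro exI[of _ B] conjI exI[of _ "d / 2"]) auto
qed

section \<open>Fejer monotone sequences approach their limit along normals\<close>

text \<open>
  Monotonicity of the distance to every \<open>c \<in> C\<close> passes to the limit, \<open>\<parallel>b - c\<parallel> \<le> \<parallel>x i - c\<parallel>\<close>, and
  expanding the square bounds \<open>(x i - b) \<bullet> (c - b)\<close> by half of \<open>\<parallel>x i - b\<parallel>\<^sup>2\<close>. Divided by \<open>\<parallel>x i - b\<parallel>\<close>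
  the bound vanishes for each fixed \<open>c\<close>, so the unit directions \<open>sgn (x i - b)\<close> cluster only at
  normals to \<open>C\<close> at \<open>b\<close>. Compactness of the sphere makes this uniform in \<open>c\<close>, even for \<open>c\<close> whose
  distance to \<open>b\<close> is comparable to that of \<open>x i\<close>.
\<close>

lemma fejer_direction_nearly_normal:
  fixes x :: "nat \<Rightarrow> 'a::euclidean_space"
  assumes lim: "x \<longlonglongrightarrow> b"
    and fejer: "\<And>i c. c \<in> C \<Longrightarrow> norm (x (Suc i) - c) \<le> norm (x i - c)"
    and ne: "\<And>i. x i \<noteq> b" and "0 < e"
  shows "\<forall>\<^sub>F i in sequentially. \<forall>c\<in>C. (x i - b) \<bullet> (c - b) \<le> e * norm (x i - b) * norm (c - b)"
proof -
  have half: "(x i - b) \<bullet> (c - b) \<le> (norm (x i - b))\<^sup>2 / 2" if c: "c \<in> C" for i c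
  proof -
    have "norm (x (i + k) - c) \<le> norm (x i - c)" for k
      by (induction k) (use fejer[OF c] order_trans in auto)
    moreover have "(\<lambda>k. norm (x (k + i) - c)) \<longlonglongrightarrow> norm (b - c)"
      by (intro tendsto_intros LIMSEQ_ignore_initial_segment lim)
    ultimately have "norm (b - c) \<le> norm (x i - c)"
      by (intro LIMSEQ_le_const2) (auto simp: add.commute)
    then have "(norm (b - c))\<^sup>2 \<le> (norm (x i - c))\<^sup>2" by (intro power_mono) auto
    moreover have "(norm (x i - c))\<^sup>2 =
        (norm (x i - b))\<^sup>2 - 2 * ((x i - b) \<bullet> (c - b)) + (norm (b - c))\<^sup>2"
      unfolding power2_norm_eq_inner by (simp add: inner_diff_left inner_diff_right inner_commute)
    ultimately show ?thesis by simp
  qed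
  define u where "u i = sgn (x i - b)" for i
  have "\<forall>\<^sub>F i in sequentially. \<exists>w\<in>normal_cone C b. dist (u i) w < e"
  proof (rule eventually_near_cluster_set[OF _ _ \<open>0 < e\<close>])
    show "bounded (range u)" by (auto simp: bounded_iff u_def norm_sgn intro!: exI[of _ 1])
    fix s w assume s: "strict_mono s" "(u \<circ> s) \<longlonglongrightarrow> w"
    have "w \<bullet> (c - b) \<le> 0" if c: "c \<in> C" for c
    proof (rule LIMSEQ_le)
      show "(\<lambda>n. (u \<circ> s) n \<bullet> (c - b)) \<longlonglongrightarrow> w \<bullet> (c - b)"
        by (intro tendsto_intros s)
      have "(\<lambda>n. norm ((x \<circ> s) n - b) / 2) \<longlonglongrightarrow> norm (b - b) / 2"
        by (intro tendsto_intros LIMSEQ_subseq_LIMSEQ[OF lim s(1)]) auto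
      then show "(\<lambda>n. norm ((x \<circ> s) n - b) / 2) \<longlonglongrightarrow> 0" by simp
      have "u i \<bullet> (c - b) \<le> norm (x i - b) / 2" for i
      proof -
        have "u i \<bullet> (c - b) = ((x i - b) \<bullet> (c - b)) / norm (x i - b)"
          by (simp add: u_def sgn_div_norm divide_inverse mult.commute)
        also have "\<dots> \<le> ((norm (x i - b))\<^sup>2 / 2) / norm (x i - b)"
          by (intro divide_right_mono half[OF c]) simp
        finally show ?thesis using ne[of i] by (simp add: power2_eq_square)
      qed
      then show "\<exists>N. \<forall>n\<ge>N. (u \<circ> s) n \<bullet> (c - b) \<le> norm ((x \<circ> s) n - b) / 2" by simp
    qed
    then show "w \<in> normal_cone C b" by (simp add: normal_cone_def)
  qed
  then show ?thesis
  proof (rule eventually_mono, intro ballI)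
    fix i c assume "\<exists>w\<in>normal_cone C b. dist (u i) w < e" and c: "c \<in> C"
    then obtain w where w: "w \<in> normal_cone C b" "dist (u i) w < e" by blast
    have "u i \<bullet> (c - b) = w \<bullet> (c - b) + (u i - w) \<bullet> (c - b)"
      by (simp add: inner_diff_left)
    also have "\<dots> \<le> 0 + norm (u i - w) * norm (c - b)"
      by (intro add_mono normal_coneD[OF w(1) c] norm_cauchy_schwarz)
    also have "\<dots> \<le> e * norm (c - b)"
      using w(2) by (simp add: dist_norm mult_right_mono)
    finally have le: "norm (x i - b) * (u i \<bullet> (c - b)) \<le> norm (x i - b) * (e * norm (c - b))"
      by (rule mult_left_mono) simp
    then show "(x i - b) \<bullet> (c - b) \<le> e * norm (x i - b) * norm (c - b)"
    proof -
      have "norm (x i - b) *\<^sub>R u i = x i - b" using ne[of i] by (simp add: u_def sgn_div_norm)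
      then have "norm (x i - b) * (u i \<bullet> (c - b)) = (x i - b) \<bullet> (c - b)"
        by (metis inner_scaleR_left)
      then show ?thesis using le by (simp add: mult_ac)
    qed
  qed
qed

text \<open>
  If \<open>x i - b\<close> were normal to \<open>C\<close> at \<open>b\<close>, then \<open>b\<close> would be the projection of \<open>x i\<close> onto \<open>C\<close>. Hence
  \<open>b\<close> is asymptotically as good as the true projection. This is what turns a lower bound for the
  distances to the individual sets into one relative to \<open>\<parallel>x i - b\<parallel>\<close> with the sharp constant.
\<close>

lemma fejer_infdist_asymptotically_dist:
  fixes x :: "nat \<Rightarrow> 'a::euclidean_space"
  assumes C: "closed C" "b \<in> C" and lim: "x \<longlonglongrightarrow> b"
    and fejer: "\<And>i c. c \<in> C \<Longrightarrow> norm (x (Suc i) - c) \<le> norm (x i - c)"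
    and ne: "\<And>i. x i \<noteq> b" and e: "0 < e"
  shows "\<forall>\<^sub>F i in sequentially. (1 - e) * norm (x i - b) \<le> infdist (x i) C"
proof -
  have "\<forall>\<^sub>F i in sequentially. \<forall>c\<in>C. (x i - b) \<bullet> (c - b) \<le> e / 2 * norm (x i - b) * norm (c - b)"
    using fejer_direction_nearly_normal[where C = C and e = "e / 2", OF lim fejer ne] e by simp
  then show ?thesis
  proof (rule eventually_mono)
    fix i assume near: "\<forall>c\<in>C. (x i - b) \<bullet> (c - b) \<le> e / 2 * norm (x i - b) * norm (c - b)"
    let ?X = "norm (x i - b)"
    obtain c where c: "c \<in> C" "infdist (x i) C = dist (x i) c"
      using infdist_attains_inf[OF C(1)] C(2) by blast
    have "norm (x i - c) \<le> ?X"
      using infdist_le[OF C(2), of "x i"] c(2) by (simp add: dist_norm)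
    then have cb: "norm (c - b) \<le> 2 * ?X"
      using norm_triangle_ineq4[of "x i - b" "x i - c"] by simp
    have "?X * ?X = (x i - b) \<bullet> (x i - c) + (x i - b) \<bullet> (c - b)"
      by (simp add: inner_diff_right flip: power2_eq_square power2_norm_eq_inner)
        (simp add: power2_norm_eq_inner inner_diff_right)
    also have "\<dots> \<le> ?X * norm (x i - c) + e / 2 * ?X * norm (c - b)"
      by (intro add_mono norm_cauchy_schwarz near[rule_format] c)
    also have "\<dots> \<le> ?X * norm (x i - c) + e / 2 * ?X * (2 * ?X)"
      by (intro add_left_mono mult_left_mono cb) (use e in auto)
    finally have "?X * ?X \<le> ?X * (norm (x i - c) + e * ?X)" by (simp add: algebra_simps)
    then have "?X \<le> norm (x i - c) + e * ?X" using ne[of i] by simp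
    then show "(1 - e) * ?X \<le> infdist (x i) C"
      by (simp add: c(2) dist_norm algebra_simps)
  qed
qed

section \<open>The angle argument\<close>

text \<open>
  In angles: if \<open>u\<close> is within \<open>arccos s\<close> of \<open>v\<close> and \<open>w\<close> is almost at a right angle to \<open>v\<close> or
  beyond, then \<open>u\<close> and \<open>w\<close> are almost \<open>arcsin s\<close> apart. The proof applies Cauchy-Schwarz to the
  components orthogonal to \<open>v\<close>.
\<close>

lemma inner_le_of_separating_direction:
  fixes u v w :: "'a::real_inner"
  assumes n: "norm u = 1" "norm v = 1" "norm w = 1"
    and s: "0 \<le> s" "s \<le> v \<bullet> u" and e: "v \<bullet> w \<le> e" "0 \<le> e"
  shows "u \<bullet> w \<le> e + sqrt (1 - s\<^sup>2)"
proof -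
  define p q where "p = v \<bullet> u" and "q = v \<bullet> w"
  have vv: "v \<bullet> v = 1" "u \<bullet> u = 1" "w \<bullet> w = 1" using n by (simp_all add: norm_eq_1)
  have p1: "p \<le> 1" using norm_cauchy_schwarz[of v u] n by (simp add: p_def)
  have p0: "0 \<le> p" using s by (simp add: p_def)
  have "u \<bullet> w = p * q + (u - p *\<^sub>R v) \<bullet> (w - q *\<^sub>R v)"
    using vv by (simp add: p_def q_def inner_diff_left inner_diff_right inner_commute algebra_simps)
  also have "\<dots> \<le> e + sqrt (1 - s\<^sup>2)"
  proof (rule add_mono)
    have "p * q \<le> p * e" using e p0 by (simp add: q_def mult_left_mono)
    also have "\<dots> \<le> e" using p1 e(2) by (simp add: mult_left_le_one_le p0)
    finally show "p * q \<le> e" .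
    have "(norm (u - p *\<^sub>R v))\<^sup>2 = 1 - p\<^sup>2"
      unfolding power2_norm_eq_inner using vv
      by (simp add: p_def inner_diff_left inner_diff_right inner_commute power2_eq_square)
    then have 1: "norm (u - p *\<^sub>R v) = sqrt (1 - p\<^sup>2)"
      by (metis norm_ge_zero real_sqrt_unique)
    have "s\<^sup>2 \<le> p\<^sup>2" using s by (simp add: p_def power_mono)
    then have 2: "norm (u - p *\<^sub>R v) \<le> sqrt (1 - s\<^sup>2)" unfolding 1 by simp
    have "(norm (w - q *\<^sub>R v))\<^sup>2 = 1 - q\<^sup>2"
      unfolding power2_norm_eq_inner using vv
      by (simp add: q_def inner_diff_left inner_diff_right inner_commute power2_eq_square)
    also have "\<dots> \<le> 1\<^sup>2" by simp
    finally have 3: "norm (w - q *\<^sub>R v) \<le> 1" by (rule power2_le_imp_le) simp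
    have "(u - p *\<^sub>R v) \<bullet> (w - q *\<^sub>R v) \<le> norm (u - p *\<^sub>R v) * norm (w - q *\<^sub>R v)"
      by (rule norm_cauchy_schwarz)
    also have "\<dots> \<le> norm (u - p *\<^sub>R v)"
      using mult_left_mono[OF 3, of "norm (u - p *\<^sub>R v)"] by simp
    finally show "(u - p *\<^sub>R v) \<bullet> (w - q *\<^sub>R v) \<le> sqrt (1 - s\<^sup>2)"
      using 2 by linarith
  qed
  finally show ?thesis .
qed

text \<open>
  The strict inequality \<open>\<alpha> < arcsin (1 / \<kappa>)\<close> leaves room for two errors, both of size \<open>\<eta>\<close>: a relative
  loss in the metric inequality, and a deviation of \<open>w\<close> from orthogonality to \<open>v\<close> in
  \<open>inner_le_of_separating_direction\<close>.
\<close>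

lemma angle_margin:
  assumes \<kappa>: "1 \<le> \<kappa>" and \<alpha>: "0 \<le> \<alpha>" "\<alpha> < arcsin (1 / \<kappa>)"
  obtains \<eta> :: real where "0 < \<eta>" "\<eta> < 1" "\<eta> + sqrt (1 - ((1 - \<eta>) / \<kappa>)\<^sup>2) < cos \<alpha>"
proof -
  have k: "-1 \<le> 1 / \<kappa>" "1 / \<kappa> \<le> 1" using \<kappa> by (auto intro: order_trans[of _ 0])
  have "cos (arcsin (1 / \<kappa>)) < cos \<alpha>"
    using \<alpha> arcsin_ubound[OF k] pi_gt_zero by (intro cos_monotone_0_pi) auto
  then have lt: "sqrt (1 - (1 / \<kappa>)\<^sup>2) < cos \<alpha>"
    using cos_arcsin[OF k] by simp
  have "((\<lambda>\<eta>. \<eta> + sqrt (1 - ((1 - \<eta>) / \<kappa>)\<^sup>2)) \<longlongrightarrow> 0 + sqrt (1 - ((1 - 0) / \<kappa>)\<^sup>2)) (at_right 0)"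
    using \<kappa> by (intro tendsto_intros) auto
  then have "\<forall>\<^sub>F \<eta> in at_right 0. \<eta> + sqrt (1 - ((1 - \<eta>) / \<kappa>)\<^sup>2) < cos \<alpha>"
    using lt by (intro order_tendstoD) auto
  moreover have "\<forall>\<^sub>F \<eta> in at_right (0::real). 0 < \<eta> \<and> \<eta> < 1"
    by (rule eventually_at_rightI[of 0 1]) auto
  ultimately have "\<forall>\<^sub>F \<eta> in at_right 0. (0 < \<eta> \<and> \<eta> < 1) \<and> \<eta> + sqrt (1 - ((1 - \<eta>) / \<kappa>)\<^sup>2) < cos \<alpha>"
    by (rule eventually_conj[rotated])
  then show thesis
    using eventually_happens'[OF trivial_limit_at_right_real] that by blast
qed

lemma inner_ge_cos_of_angle_le:
  assumes "norm u = 1" "norm w = 1" "angle u w \<le> \<alpha>" "\<alpha> \<le> pi"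
  shows "cos \<alpha> \<le> u \<bullet> w"
proof -
  have "\<bar>u \<bullet> w\<bar> \<le> 1" using Cauchy_Schwarz_ineq2[of u w] assms by simp
  then have uw: "-1 \<le> u \<bullet> w" "u \<bullet> w \<le> 1" by auto
  have "arccos (u \<bullet> w) \<le> \<alpha>" using assms by (simp add: angle_def)
  then have "cos \<alpha> \<le> cos (arccos (u \<bullet> w))"
    using arccos_lbound[OF uw] assms(4) by (intro cos_monotone_0_pi_le) auto
  then show ?thesis using uw by simp
qed

section \<open>One window of the algorithm\<close>

text \<open>
  Both rates come from one estimate, in which \<open>c * t ^ m\<close> bounds how far from \<open>b\<close> a supporting
  hyperplane generated by an iterate at distance \<open>t\<close> can pass (\<open>m = 1\<close> with \<open>c\<close> small in
  general, \<open>m = 2\<close> under the second order condition).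

  Among the directions \<open>sgn (x j - b)\<close> in a window of length \<open>p\<close>, two with \<open>j < k\<close> are at most \<open>\<alpha>\<close>
  apart. Take the set \<open>K l\<close> farthest from \<open>x j\<close>. The metric inequality makes the unit normal \<open>v\<close> of
  the halfspace that it generates satisfy \<open>v \<bullet> (x j - b) \<ge> s * \<parallel>x j - b\<parallel>\<close> with \<open>s\<close> close
  to \<open>1 / \<kappa>\<close>. As \<open>\<alpha> < arcsin (1 / \<kappa>)\<close>, the direction of \<open>x k - b\<close> cannot be nearly
  orthogonal to \<open>v\<close> or beyond: \<open>\<eta> * \<parallel>x k - b\<parallel> < v \<bullet> (x k - b)\<close>. But \<open>x k\<close> lies in the halfspace, so the right
  side is at most the distance by which its boundary misses \<open>b\<close>.
\<close>

lemma shqp_window_estimate: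
  fixes K :: "nat \<Rightarrow> 'a::euclidean_space set" and x :: "nat \<Rightarrow> 'a"
  assumes r: "1 \<le> r"
    and K: "\<And>l. l \<in> {1..r} \<Longrightarrow> closed (K l) \<and> convex (K l)"
    and b: "b \<in> (\<Inter>l\<in>{1..r}. K l)"
    and run: "shqp r K p S x" and lim: "x \<longlonglongrightarrow> b" and ne: "\<And>i. x i \<noteq> b"
    and \<kappa>0: "0 < \<kappa>" and lmi: "local_metric_inequality r K b \<kappa>"
    and \<alpha>: "\<alpha> < arcsin (1 / \<kappa>)"
    and dirs: "\<And>u :: nat \<Rightarrow> 'a. (\<forall>j<p. norm (u j) = 1)
      \<Longrightarrow> \<exists>j<p. \<exists>k<p. j \<noteq> k \<and> angle (u j) (u k) \<le> \<alpha>"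
    and S: "\<And>i. S i = {i - p..i} \<times> {1..r}"
  obtains \<eta> where "0 < \<eta>"
    "\<And>c m. 0 \<le> c \<Longrightarrow>
      \<forall>\<^sub>F i in sequentially. \<forall>l\<in>{1..r}. \<forall>v\<in>normal_cone (K l) (closest_point (K l) (x i)).
        norm v = 1 \<longrightarrow> v \<bullet> (closest_point (K l) (x i) - b) \<le> c * norm (x i - b) ^ m \<Longrightarrow>
      \<forall>\<^sub>F i in sequentially. \<eta> * norm (x (i + p) - b) \<le> c * norm (x i - b) ^ m"
proof -
  define D where "D = (\<Inter>l\<in>{1..r}. K l)"
  have Kb: "closed (K l)" "convex (K l)" "b \<in> K l" if "l \<in> {1..r}" for l using K b that by auto
  have D: "closed D" "b \<in> D" using Kb by (auto simp: D_def)
  have fejer: "norm (x (Suc i) - c) \<le> norm (x i - c)" if "c \<in> D" for i c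
    using run that by (auto simp: shqp_def D_def)
  have decr: "norm (x k - b) \<le> norm (x j - b)" if "j \<le> k" for j k
    using lift_Suc_antimono_le[of "\<lambda>i. norm (x i - b)"] fejer[OF D(2)] that by blast
  have half: "shqp_a (K l) (x j) \<bullet> x k \<le> shqp_b (K l) (x j)"
    if "j < k" "k \<le> j + p" "l \<in> {1..r}" for j k l
  proof -
    obtain m where m: "k = Suc m" using \<open>j < k\<close> by (cases k) auto
    have "(j, l) \<in> S m" using that by (auto simp: S m)
    moreover have "x (Suc m) \<in> (\<Inter>(j, l)\<in>S m. shqp_halfspace (K l) (x j))"
      using run by (simp add: shqp_def)
    ultimately show ?thesis by (auto simp: shqp_halfspace_def m)
  qed
  obtain d where d: "0 < d" and dK: "\<And>y. y \<in> cball b d \<Longrightarrow>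
      infdist y D \<le> \<kappa> * Max ((\<lambda>l. infdist y (K l)) ` {1..r})"
    using lmi unfolding local_metric_inequality_def D_def by blast
  have "\<forall>\<^sub>F i in sequentially. dist (x i) b < d" using lim d by (rule tendstoD)
  then have near: "\<forall>\<^sub>F i in sequentially. \<exists>l\<in>{1..r}. infdist (x i) D \<le> \<kappa> * infdist (x i) (K l)"
  proof (rule eventually_mono)
    fix i assume "dist (x i) b < d"
    then have le: "infdist (x i) D \<le> \<kappa> * Max ((\<lambda>l. infdist (x i) (K l)) ` {1..r})"
      by (intro dK) (simp add: dist_commute)
    have "Max ((\<lambda>l. infdist (x i) (K l)) ` {1..r}) \<in> (\<lambda>l. infdist (x i) (K l)) ` {1..r}"
      using r by (intro Max_in) auto
    with le show "\<exists>l\<in>{1..r}. infdist (x i) D \<le> \<kappa> * infdist (x i) (K l)" by force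
  qed
  have asymp: "\<forall>\<^sub>F i in sequentially. (1 - e) * norm (x i - b) \<le> infdist (x i) D" if "0 < e" for e
    using fejer_infdist_asymptotically_dist[OF D lim fejer ne that] by simp
  \<comment> \<open>The iterates stay outside \<open>D\<close>, so the metric inequality is not vacuous along them; this puts
    \<open>1 / \<kappa>\<close> in the domain on which \<open>arcsin\<close> inverts \<open>sin\<close>.\<close>
  have \<kappa>: "1 \<le> \<kappa>"
  proof -
    obtain i l where i: "l \<in> {1..r}" "infdist (x i) D \<le> \<kappa> * infdist (x i) (K l)"
      "(1 - 1 / 2) * norm (x i - b) \<le> infdist (x i) D"
      using eventually_conj[OF near asymp[of "1 / 2"]] by (auto simp: eventually_sequentially)
    have "infdist (x i) (K l) \<le> infdist (x i) D"
      using i(1) D(2) by (intro infdist_mono) (auto simp: D_def)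
    then have "infdist (x i) D \<le> \<kappa> * infdist (x i) D"
      using i(2) \<kappa>0 by (meson mult_left_mono order_trans less_imp_le)
    moreover have "0 < infdist (x i) D"
    proof (rule less_le_trans[OF _ i(3)])
      show "0 < (1 - 1 / 2) * norm (x i - b)" using ne[of i] by simp
    qed
    ultimately show ?thesis by simp
  qed
  have k1: "-1 \<le> 1 / \<kappa>" "1 / \<kappa> \<le> 1" using \<kappa> by (auto intro: order_trans[of _ 0])
  \<comment> \<open>The hypothesis on directions, applied to a constant family, compares a vector with itself.\<close>
  have "0 \<le> \<alpha>"
  proof -
    define e where "e = sgn (x 0 - b)"
    have "norm e = 1" using ne by (simp add: e_def norm_sgn)
    moreover from this have "e \<bullet> e = 1" by (simp add: norm_eq_1)
    ultimately show ?thesis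
      using dirs[of "\<lambda>_. e"] by (auto simp: angle_def)
  qed
  have "\<alpha> \<le> pi" using \<alpha> arcsin_ubound[OF k1] pi_gt_zero by linarith
  obtain \<eta> where \<eta>: "0 < \<eta>" "\<eta> < 1" "\<eta> + sqrt (1 - ((1 - \<eta>) / \<kappa>)\<^sup>2) < cos \<alpha>"
    using angle_margin[OF \<kappa> \<open>0 \<le> \<alpha>\<close> \<alpha>] .
  define s where "s = (1 - \<eta>) / \<kappa>"
  have s: "0 < s" using \<eta> \<kappa>0 by (simp add: s_def)
  have far: "\<forall>\<^sub>F i in sequentially. \<exists>l\<in>{1..r}. s * norm (x i - b) \<le> norm (shqp_a (K l) (x i))"
    using near asymp[OF \<eta>(1)]
  proof eventually_elim
    case (elim i)
    then obtain l where l: "l \<in> {1..r}" "(1 - \<eta>) * norm (x i - b) \<le> \<kappa> * infdist (x i) (K l)"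
      by force
    moreover have "infdist (x i) (K l) = norm (shqp_a (K l) (x i))"
      using Kb[OF l(1)] by (intro infdist_eq_norm_shqp_a) auto
    ultimately have "s * norm (x i - b) \<le> norm (shqp_a (K l) (x i))"
      using \<kappa>0 by (simp add: s_def field_simps)
    then show ?case using l(1) by blast
  qed
  show thesis
  proof (rule that[OF \<eta>(1)])
    fix c m assume c: "0 \<le> (c::real)"
      and miss: "\<forall>\<^sub>F i in sequentially. \<forall>l\<in>{1..r}.
        \<forall>v\<in>normal_cone (K l) (closest_point (K l) (x i)).
          norm v = 1 \<longrightarrow> v \<bullet> (closest_point (K l) (x i) - b) \<le> c * norm (x i - b) ^ m"
    obtain N where N: "\<And>i. N \<le> i \<Longrightarrow> (\<exists>l\<in>{1..r}. s * norm (x i - b) \<le> norm (shqp_a (K l) (x i)))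
        \<and> (\<forall>l\<in>{1..r}. \<forall>v\<in>normal_cone (K l) (closest_point (K l) (x i)).
          norm v = 1 \<longrightarrow> v \<bullet> (closest_point (K l) (x i) - b) \<le> c * norm (x i - b) ^ m)"
      using eventually_conj[OF far miss] by (auto simp: eventually_sequentially)
    have "\<eta> * norm (x (i + p) - b) \<le> c * norm (x i - b) ^ m" if i: "N \<le> i" for i
    proof -
      define u where "u j = sgn (x j - b)" for j
      have u: "norm (u j) = 1" "norm (x j - b) *\<^sub>R u j = x j - b" for j
        using ne[of j] by (simp_all add: u_def norm_sgn sgn_div_norm)
      obtain j' k' where jk': "j' < p" "k' < p" "j' \<noteq> k'" "angle (u (i + j')) (u (i + k')) \<le> \<alpha>"
        using dirs[of "\<lambda>j. u (i + j)"] u(1) by auto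
      obtain j k where jk: "i \<le> j" "j < k" "k < i + p" "angle (u j) (u k) \<le> \<alpha>"
      proof (cases "j' < k'")
        case True
        then show ?thesis using that[of "i + j'" "i + k'"] jk' by simp
      next
        case False
        then show ?thesis
          using that[of "i + k'" "i + j'"] jk' by (simp add: angle_def inner_commute mult.commute)
      qed
      have ujk: "cos \<alpha> \<le> u j \<bullet> u k"
        using jk(4) \<open>\<alpha> \<le> pi\<close> by (intro inner_ge_cos_of_angle_le u)
      obtain l where l: "l \<in> {1..r}" "s * norm (x j - b) \<le> norm (shqp_a (K l) (x j))"
        using N[of j] i jk(1) by auto
      define a where "a = shqp_a (K l) (x j)"
      define P where "P = closest_point (K l) (x j)"
      define v where "v = sgn a"
      have a0: "0 < norm a"
        unfolding a_def by (rule less_le_trans[OF _ l(2)]) (use s ne[of j] in simp)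
      have v: "norm v = 1" using a0 by (simp add: v_def norm_sgn)
      have a_v: "a = norm a *\<^sub>R v" using a0 by (simp add: v_def sgn_div_norm)
      have aN: "a \<in> normal_cone (K l) P"
        unfolding a_def P_def using Kb[OF l(1)] by (intro shqp_a_normal) auto
      have vN: "v \<in> normal_cone (K l) P"
        using normal_cone_scaleR[OF _ aN, of "inverse (norm a)"] by (simp add: v_def sgn_div_norm)
      have "v \<bullet> (x j - b) = v \<bullet> a - v \<bullet> (b - P)"
        by (simp add: a_def P_def shqp_a_def inner_diff_right)
      moreover have "v \<bullet> a = norm a"
        by (subst a_v) (use v in \<open>simp add: norm_eq_1\<close>)
      moreover have "v \<bullet> (b - P) \<le> 0" by (rule normal_coneD[OF vN Kb(3)[OF l(1)]])
      ultimately have "norm a \<le> v \<bullet> (x j - b)" by simp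
      with l(2) have "s * norm (x j - b) \<le> norm (x j - b) * (v \<bullet> u j)"
        unfolding a_def[symmetric] using u(2)[of j] by (metis inner_scaleR_right order_trans)
      then have vj: "s \<le> v \<bullet> u j" using ne[of j] by (simp add: mult.commute)
      have vk: "\<eta> < v \<bullet> u k"
      proof (rule ccontr)
        assume "\<not> \<eta> < v \<bullet> u k"
        then have "u j \<bullet> u k \<le> \<eta> + sqrt (1 - s\<^sup>2)"
          using s \<eta>(1) vj v u(1) by (intro inner_le_of_separating_direction[of _ v]) auto
        then show False using ujk \<eta>(3) by (simp add: s_def)
      qed
      have "\<eta> * norm (x (i + p) - b) \<le> \<eta> * norm (x k - b)"
        using decr[of k "i + p"] jk(3) \<eta>(1) by simp
      also have "\<dots> \<le> (v \<bullet> u k) * norm (x k - b)"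
        using vk by (intro mult_right_mono) auto
      also have "\<dots> = v \<bullet> (x k - b)"
        using u(2)[of k] by (metis inner_scaleR_right mult.commute)
      also have "\<dots> \<le> v \<bullet> (P - b)"
      proof -
        have "a \<bullet> x k \<le> a \<bullet> P"
          using half[OF jk(2) _ l(1)] jk(1,3) by (simp add: shqp_b_def a_def P_def)
        then have "norm a * (v \<bullet> x k) \<le> norm a * (v \<bullet> P)"
          using a_v by (metis inner_scaleR_left)
        then show ?thesis using a0 by (simp add: inner_diff_right)
      qed
      also have "\<dots> \<le> c * norm (x j - b) ^ m"
        using N[of j] i jk(1) l(1) vN v by (auto simp: P_def)
      also have "\<dots> \<le> c * norm (x i - b) ^ m"
        using c decr[OF jk(1)] by (intro mult_left_mono power_mono) auto
      finally show ?thesis .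
    qed
    then show "\<forall>\<^sub>F i in sequentially. \<eta> * norm (x (i + p) - b) \<le> c * norm (x i - b) ^ m"
      by (auto simp: eventually_sequentially)
  qed
qed

section \<open>Rates of convergence\<close>

text \<open>
  Normals at the projection of \<open>x i\<close> onto \<open>C\<close> are controlled by the distance of \<open>x i\<close> itself, because
  projections do not increase the distance to \<open>b\<close>.
\<close>

lemma projected_hyperplane_misses_little:
  fixes C :: "'a::euclidean_space set"
  assumes C: "closed C" "convex C" "b \<in> C" and lim: "x \<longlonglongrightarrow> b" and "0 < e"
  shows "\<forall>\<^sub>F i in sequentially. \<forall>v\<in>normal_cone C (closest_point C (x i)).
    norm v = 1 \<longrightarrow> v \<bullet> (closest_point C (x i) - b) \<le> e * norm (x i - b)"
proof -
  obtain d where d: "0 < d" "\<And>y v. y \<in> C \<Longrightarrow> dist y b \<le> d \<Longrightarrow> v \<in> normal_cone C y \<Longrightarrow> norm v = 1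
      \<Longrightarrow> v \<bullet> (y - b) \<le> e * norm (y - b)"
    using supporting_hyperplane_near[OF \<open>0 < e\<close>] by blast
  from tendstoD[OF lim d(1)] show ?thesis
  proof (rule eventually_mono, intro ballI impI)
    fix i v assume i: "dist (x i) b < d" and v: "v \<in> normal_cone C (closest_point C (x i))" "norm v = 1"
    have le: "dist (closest_point C (x i)) b \<le> dist (x i) b" by (rule dist_closest_point_le[OF C])
    have "closest_point C (x i) \<in> C" using C by (intro closest_point_in_set) auto
    then have "v \<bullet> (closest_point C (x i) - b) \<le> e * norm (closest_point C (x i) - b)"
      using le i v by (intro d(2)) auto
    also have "\<dots> \<le> e * norm (x i - b)"
      using le \<open>0 < e\<close> by (simp add: dist_norm)
    finally show "v \<bullet> (closest_point C (x i) - b) \<le> e * norm (x i - b)" .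
  qed
qed

lemma SOSH_projected_hyperplane_misses_quadratically:
  fixes C :: "'a::euclidean_space set"
  assumes C: "closed C" "convex C" "b \<in> C" and lim: "x \<longlonglongrightarrow> b" and "SOSH C b"
  obtains M where "0 < M"
    "\<forall>\<^sub>F i in sequentially. \<forall>v\<in>normal_cone C (closest_point C (x i)).
      norm v = 1 \<longrightarrow> v \<bullet> (closest_point C (x i) - b) \<le> M * (norm (x i - b))\<^sup>2"
proof -
  obtain d M where d: "0 < d" and M: "0 < M"
    and dM: "\<And>y v. y \<in> (cball b d \<inter> C) - {b} \<Longrightarrow> v \<in> normal_cone C y \<Longrightarrow> norm v = 1
      \<Longrightarrow> - (v \<bullet> (b - y)) \<le> M * (norm (b - y))\<^sup>2"
    using \<open>SOSH C b\<close> unfolding SOSH_def by blast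
  show thesis
  proof (rule that[OF M])
    from tendstoD[OF lim d] show "\<forall>\<^sub>F i in sequentially.
      \<forall>v\<in>normal_cone C (closest_point C (x i)).
        norm v = 1 \<longrightarrow> v \<bullet> (closest_point C (x i) - b) \<le> M * (norm (x i - b))\<^sup>2"
    proof (rule eventually_mono, intro ballI impI)
      fix i v assume i: "dist (x i) b < d"
        and v: "v \<in> normal_cone C (closest_point C (x i))" "norm v = 1"
      define y where "y = closest_point C (x i)"
      have le: "dist y b \<le> dist (x i) b" unfolding y_def by (rule dist_closest_point_le[OF C])
      have "y \<in> C" unfolding y_def using C by (intro closest_point_in_set) auto
      have "v \<bullet> (y - b) \<le> M * (norm (b - y))\<^sup>2"
      proof (cases "y = b")
        case False
        have "- (v \<bullet> (b - y)) \<le> M * (norm (b - y))\<^sup>2"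
          by (rule dM) (use False le i \<open>y \<in> C\<close> v in \<open>auto simp: y_def dist_commute\<close>)
        then show ?thesis by (simp add: inner_diff_right)
      qed simp
      also have "\<dots> \<le> M * (norm (x i - b))\<^sup>2"
        using le M by (intro mult_left_mono power_mono) (auto simp: dist_norm norm_minus_commute)
      finally show "v \<bullet> (closest_point C (x i) - b) \<le> M * (norm (x i - b))\<^sup>2"
        by (simp add: y_def)
    qed
  qed
qed

theorem corollary3p11:
  fixes K :: "nat \<Rightarrow> (real ^ 'n) set" and r :: nat and xbar :: "real ^ 'n"
  assumes "1 \<le> r"
    and "\<And>l. l \<in> {1..r} \<Longrightarrow> closed (K l) \<and> convex (K l)"
    and "xbar \<in> (\<Inter>l\<in>{1..r}. K l)"
    and "\<And>v :: nat \<Rightarrow> real ^ 'n.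
           (\<forall>l\<in>{1..r}. v l \<in> normal_cone (K l) xbar) \<Longrightarrow> (\<Sum>l=1..r. v l) = 0 \<Longrightarrow>
           \<forall>l\<in>{1..r}. v l = 0"
  shows "(\<exists>\<kappa>>0. local_metric_inequality r K xbar \<kappa>) \<and>
    (\<forall>(p :: nat) (S :: nat \<Rightarrow> (nat \<times> nat) set) (x :: nat \<Rightarrow> real ^ 'n) (\<kappa> :: real) (\<alpha> :: real).
       shqp r K p S x \<longrightarrow>
       x \<longlonglongrightarrow> xbar \<longrightarrow>
       (\<forall>i. x i \<noteq> xbar) \<longrightarrow>
       0 < \<kappa> \<longrightarrow>
       local_metric_inequality r K xbar \<kappa> \<longrightarrow>
       \<alpha> < arcsin (1 / \<kappa>) \<longrightarrow>
       (\<forall>u :: nat \<Rightarrow> real ^ 'n. (\<forall>j<p. norm (u j) = 1) \<longrightarrow>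
          (\<exists>j<p. \<exists>k<p. j \<noteq> k \<and> angle (u j) (u k) \<le> \<alpha>)) \<longrightarrow>
       (\<forall>i. S i = {i - p..i} \<times> {1..r}) \<longrightarrow>
       (\<lambda>i. norm (x (i + p) - xbar) / norm (x i - xbar)) \<longlonglongrightarrow> 0 \<and>
       ((\<forall>l\<in>{1..r}. SOSH (K l) xbar) \<longrightarrow>
          limsup (\<lambda>i. ereal (norm (x (i + p) - xbar) / (norm (x i - xbar))\<^sup>2)) < \<infinity>))"
proof (intro conjI allI impI)
  note K = assms(2) and b = assms(3)
  show "\<exists>\<kappa>>0. local_metric_inequality r K xbar \<kappa>"
    by (rule local_metric_inequality_exists[OF assms(1-3)]) (use assms(4) in blast)+
  fix p :: nat and S :: "nat \<Rightarrow> (nat \<times> nat) set" and x :: "nat \<Rightarrow> real ^ 'n" and \<kappa> \<alpha> :: real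
  assume run: "shqp r K p S x" and lim: "x \<longlonglongrightarrow> xbar" and ne: "\<forall>i. x i \<noteq> xbar"
    and lmi: "0 < \<kappa>" "local_metric_inequality r K xbar \<kappa>" and \<alpha>: "\<alpha> < arcsin (1 / \<kappa>)"
    and dirs: "\<forall>u :: nat \<Rightarrow> real ^ 'n. (\<forall>j<p. norm (u j) = 1) \<longrightarrow>
      (\<exists>j<p. \<exists>k<p. j \<noteq> k \<and> angle (u j) (u k) \<le> \<alpha>)"
    and S: "\<forall>i. S i = {i - p..i} \<times> {1..r}"
  have Kb: "closed (K l)" "convex (K l)" "xbar \<in> K l" if "l \<in> {1..r}" for l
    using K[OF that] b that by auto
  obtain \<eta> where \<eta>: "0 < \<eta>" and est: "\<And>c m. 0 \<le> c \<Longrightarrow>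
      \<forall>\<^sub>F i in sequentially. \<forall>l\<in>{1..r}. \<forall>v\<in>normal_cone (K l) (closest_point (K l) (x i)).
        norm v = 1 \<longrightarrow> v \<bullet> (closest_point (K l) (x i) - xbar) \<le> c * norm (x i - xbar) ^ m \<Longrightarrow>
      \<forall>\<^sub>F i in sequentially. \<eta> * norm (x (i + p) - xbar) \<le> c * norm (x i - xbar) ^ m"
    by (rule shqp_window_estimate[OF assms(1) K b run lim ne[rule_format] lmi \<alpha> dirs[rule_format]
          S[rule_format]]) blast+
  have pos: "0 < norm (x i - xbar)" for i using ne by simp
  show "(\<lambda>i. norm (x (i + p) - xbar) / norm (x i - xbar)) \<longlonglongrightarrow> 0"
  proof (rule tendstoI)
    fix e :: real assume e: "0 < e"
    have "\<forall>\<^sub>F i in sequentially. \<eta> * norm (x (i + p) - xbar) \<le> (\<eta> * e / 2) * norm (x i - xbar) ^ 1"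
    proof (rule est)
      show "\<forall>\<^sub>F i in sequentially. \<forall>l\<in>{1..r}. \<forall>v\<in>normal_cone (K l) (closest_point (K l) (x i)).
        norm v = 1 \<longrightarrow>
          v \<bullet> (closest_point (K l) (x i) - xbar) \<le> (\<eta> * e / 2) * norm (x i - xbar) ^ 1"
        unfolding power_one_right
        using \<eta> e by (intro eventually_ball_finite finite_atLeastAtMost ballI
            projected_hyperplane_misses_little Kb lim) auto
    qed (use \<eta> e in simp)
    then show "\<forall>\<^sub>F i in sequentially. dist (norm (x (i + p) - xbar) / norm (x i - xbar)) 0 < e"
    proof (rule eventually_mono)
      fix i assume "\<eta> * norm (x (i + p) - xbar) \<le> (\<eta> * e / 2) * norm (x i - xbar) ^ 1"
      then have "\<eta> * norm (x (i + p) - xbar) \<le> \<eta> * (e / 2 * norm (x i - xbar))" by simp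
      then have "norm (x (i + p) - xbar) \<le> e / 2 * norm (x i - xbar)"
        using \<eta> by (simp only: mult_le_cancel_left_pos)
      also have "\<dots> < e * norm (x i - xbar)" using e pos[of i] by simp
      finally show "dist (norm (x (i + p) - xbar) / norm (x i - xbar)) 0 < e"
        using pos[of i] by (simp add: divide_less_eq)
    qed
  qed
  assume sosh: "\<forall>l\<in>{1..r}. SOSH (K l) xbar"
  have "\<forall>l\<in>{1..r}. \<exists>M. 0 < M \<and>
      (\<forall>\<^sub>F i in sequentially. \<forall>v\<in>normal_cone (K l) (closest_point (K l) (x i)).
        norm v = 1 \<longrightarrow> v \<bullet> (closest_point (K l) (x i) - xbar) \<le> M * (norm (x i - xbar))\<^sup>2)"
  proof (intro ballI)
    fix l assume l: "l \<in> {1..r}"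
    show "\<exists>M. 0 < M \<and>
      (\<forall>\<^sub>F i in sequentially. \<forall>v\<in>normal_cone (K l) (closest_point (K l) (x i)).
        norm v = 1 \<longrightarrow> v \<bullet> (closest_point (K l) (x i) - xbar) \<le> M * (norm (x i - xbar))\<^sup>2)"
      by (rule SOSH_projected_hyperplane_misses_quadratically[OF Kb[OF l] lim sosh[rule_format, OF l]])
        blast
  qed
  from bchoice[OF this] obtain M where "\<forall>l\<in>{1..r}. 0 < M l \<and>
      (\<forall>\<^sub>F i in sequentially. \<forall>v\<in>normal_cone (K l) (closest_point (K l) (x i)).
        norm v = 1 \<longrightarrow> v \<bullet> (closest_point (K l) (x i) - xbar) \<le> M l * (norm (x i - xbar))\<^sup>2)"
    by blast
  then have M: "\<And>l. l \<in> {1..r} \<Longrightarrow> 0 < M l"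
    "\<And>l. l \<in> {1..r} \<Longrightarrow> \<forall>\<^sub>F i in sequentially.
      \<forall>v\<in>normal_cone (K l) (closest_point (K l) (x i)).
        norm v = 1 \<longrightarrow> v \<bullet> (closest_point (K l) (x i) - xbar) \<le> M l * (norm (x i - xbar))\<^sup>2"
    by blast+
  define c where "c = (\<Sum>l=1..r. M l)"
  have c0: "0 \<le> c" unfolding c_def by (rule sum_nonneg) (use M(1) in \<open>auto intro: less_imp_le\<close>)
  have Mc: "M l \<le> c" if "l \<in> {1..r}" for l
    unfolding c_def by (rule member_le_sum) (use that M(1) in \<open>auto intro: less_imp_le\<close>)
  have "\<forall>\<^sub>F i in sequentially. \<eta> * norm (x (i + p) - xbar) \<le> c * (norm (x i - xbar))\<^sup>2"
  proof (rule est[OF c0], intro eventually_ball_finite finite_atLeastAtMost ballI)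
    fix l assume l: "l \<in> {1..r}"
    show "\<forall>\<^sub>F i in sequentially. \<forall>v\<in>normal_cone (K l) (closest_point (K l) (x i)).
      norm v = 1 \<longrightarrow> v \<bullet> (closest_point (K l) (x i) - xbar) \<le> c * (norm (x i - xbar))\<^sup>2"
      using M(2)[OF l]
    proof (rule eventually_mono, intro ballI impI)
      fix i v
      assume "\<forall>v\<in>normal_cone (K l) (closest_point (K l) (x i)).
          norm v = 1 \<longrightarrow> v \<bullet> (closest_point (K l) (x i) - xbar) \<le> M l * (norm (x i - xbar))\<^sup>2"
        and "v \<in> normal_cone (K l) (closest_point (K l) (x i))" "norm v = 1"
      then have "v \<bullet> (closest_point (K l) (x i) - xbar) \<le> M l * (norm (x i - xbar))\<^sup>2" by blast
      also have "\<dots> \<le> c * (norm (x i - xbar))\<^sup>2" by (intro mult_right_mono Mc l) simp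
      finally show "v \<bullet> (closest_point (K l) (x i) - xbar) \<le> c * (norm (x i - xbar))\<^sup>2" .
    qed
  qed
  then have "\<forall>\<^sub>F i in sequentially.
      ereal (norm (x (i + p) - xbar) / (norm (x i - xbar))\<^sup>2) \<le> ereal (c / \<eta>)"
  proof (rule eventually_mono)
    fix i assume "\<eta> * norm (x (i + p) - xbar) \<le> c * (norm (x i - xbar))\<^sup>2"
    then show "ereal (norm (x (i + p) - xbar) / (norm (x i - xbar))\<^sup>2) \<le> ereal (c / \<eta>)"
      using \<eta> zero_less_power[OF pos[of i], of 2]
      by (simp add: divide_le_eq pos_le_divide_eq mult.commute)
  qed
  then have "limsup (\<lambda>i. ereal (norm (x (i + p) - xbar) / (norm (x i - xbar))\<^sup>2)) \<le> ereal (c / \<eta>)"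
    by (rule Limsup_bounded)
  also have "\<dots> < \<infinity>" by simp
  finally show "limsup (\<lambda>i. ereal (norm (x (i + p) - xbar) / (norm (x i - xbar))\<^sup>2)) < \<infinity>" .
qed

end
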